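(* Let $k\ge 1$ be an integer and let $(P_{k,n})_{n\ge0}$ be the generalized $k$-Pell-Tribonacci sequence. For every integer $n\geq 0$, $$\sum_{i=0}^{n}iP_{k,i}^2=\frac{a_1P_{k,n+3}^2+a_2P_{k,n+2}^2+a_3P_{k,n+1}^2}{9k^2(k+2)^2}+\frac{b_1P_{k,n+1}P_{k,n+2}+b_2P_{k,n+2}P_{k,n+3}+b_3P_{k,n+1}P_{k,n+3}+c_1}{9k^2(k+2)^2},$$ where $$\begin{aligned} a_1&=-3k(k+2)n-(7k^2+14k+9),\\ a_2&=-3k(k+2)(2k+1)^2n-(28k^4+72k^3+60k^2+20k+9),\\ a_3&=-3k(k+2)(3k^2+6k+1)n-(9k^4+36k^3+46k^2+20k+9),\\ b_1&=-6k(k+2)(k-1)n-(20k^3+20k^2-16k-6),\\ b_2&=6k(k+2)(2k+1)n+(28k^3+64k^2+46k+6),\\ b_3&=6k(k+2)n+(14k^2+22k+6),\\ c_1&=k^2+2k+9. \end{aligned}$$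
   Context: For an integer $k\geq 1$, the generalized $k$-Pell-Tribonacci sequence $(P_{k,n})_{n\ge 0}$ is defined by $P_{k,0}=0$, $P_{k,1}=1$, $P_{k,2}=2k$ and $P_{k,n}=2kP_{k,n-1}+kP_{k,n-2}+P_{k,n-3}$ for $n\geq 3$. *)

theory Defs
  imports Complex_Main
begin

fun pell_tribonacci :: "int \<Rightarrow> nat \<Rightarrow> int" where
  "pell_tribonacci k 0 = 0"
| "pell_tribonacci k (Suc 0) = 1"
| "pell_tribonacci k (Suc (Suc 0)) = 2 * k"
| "pell_tribonacci k (Suc (Suc (Suc n))) =
     2 * k * pell_tribonacci k (Suc (Suc n)) + k * pell_tribonacci k (Suc n) + pell_tribonacci k n"

end

theory Submission
  imports Defs
begin

text \<open>The sum telescopes. With the denominator cleared, the right side is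
  \<open>Q n (x, y, z) + c1\<close>, where \<open>Q n\<close> is a quadratic form in three
  consecutive terms whose coefficients are affine in \<open>n\<close>. One step of the recurrence
  sends the window \<open>(x, y, z)\<close> to \<open>(y, z, 2 * k * z + k * y + x)\<close>, and the
  coefficients are such that \<open>Q\<close> then grows by exactly
  \<open>9 * k^2 * (k + 2)^2 * (n + 1) * x^2\<close>, the next summand. Induction on
  \<open>n\<close> gives this lemma over the integers; the theorem divides it by the common
  denominator.\<close>

lemma pell_tribonacci_weighted_square_sum:
  fixes k :: int and n :: nat
  defines "x \<equiv> pell_tribonacci k (n + 1)"
    and "y \<equiv> pell_tribonacci k (n + 2)"
    and "z \<equiv> pell_tribonacci k (n + 3)"
  shows "9 * k^2 * (k + 2)^2 * (\<Sum>i=0..n. int i * (pell_tribonacci k i)^2) =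
      (- 3 * k * (k + 2) * int n - (7 * k^2 + 14 * k + 9)) * z^2
    + (- 3 * k * (k + 2) * (2 * k + 1)^2 * int n
        - (28 * k^4 + 72 * k^3 + 60 * k^2 + 20 * k + 9)) * y^2
    + (- 3 * k * (k + 2) * (3 * k^2 + 6 * k + 1) * int n
        - (9 * k^4 + 36 * k^3 + 46 * k^2 + 20 * k + 9)) * x^2
    + (- 6 * k * (k + 2) * (k - 1) * int n - (20 * k^3 + 20 * k^2 - 16 * k - 6)) * x * y
    + (6 * k * (k + 2) * (2 * k + 1) * int n + (28 * k^3 + 64 * k^2 + 46 * k + 6)) * y * z
    + (6 * k * (k + 2) * int n + (14 * k^2 + 22 * k + 6)) * x * z
    + (k^2 + 2 * k + 9)"
  unfolding x_def y_def z_def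
proof (induction n)
  case 0
  \<comment> \<open>The window is \<open>(1, 2 * k, 4 * k^2 + k)\<close> and the sum is 0: this case
    fixes the constant \<open>c1\<close>, which cancels in the induction step.\<close>
  show ?case
    by (simp add: eval_nat_numeral algebra_simps)
next
  case (Suc n)
  define x y z where "x = pell_tribonacci k (n + 1)"
    and "y = pell_tribonacci k (n + 2)" and "z = pell_tribonacci k (n + 3)"
  have shift: "pell_tribonacci k (Suc n + 1) = y" "pell_tribonacci k (Suc n + 2) = z"
      "pell_tribonacci k (Suc n) = x"
    by (simp_all add: x_def y_def z_def eval_nat_numeral)
  have rec: "pell_tribonacci k (Suc n + 3) = 2 * k * z + k * y + x"
    by (simp add: x_def y_def z_def eval_nat_numeral)
  have sum: "9 * k^2 * (k + 2)^2 * (\<Sum>i=0..Suc n. int i * (pell_tribonacci k i)^2) =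
      9 * k^2 * (k + 2)^2 * (\<Sum>i=0..n. int i * (pell_tribonacci k i)^2)
      + 9 * k^2 * (k + 2)^2 * ((int n + 1) * x^2)"
    by (simp add: shift distrib_left add.commute)
  have int_Suc: "int (Suc n) = int n + 1"
    by simp
  \<comment> \<open>With the fourth term eliminated by \<open>rec\<close>, no relation among
    \<open>x\<close>, \<open>y\<close>, \<open>z\<close> is used any more: the goal is a polynomial
    identity in \<open>k\<close>, \<open>n\<close>, \<open>x\<close>, \<open>y\<close>,
    \<open>z\<close> and the old sum.\<close>
  show ?case
    unfolding sum Suc.IH rec shift int_Suc x_def[symmetric] y_def[symmetric] z_def[symmetric]
    by algebra
qed

theorem proposition5:
  fixes k :: int and n :: nat and a1 a2 a3 b1 b2 b3 c1 :: int
  assumes "k \<ge> 1"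
    and "a1 = - 3 * k * (k + 2) * int n - (7 * k^2 + 14 * k + 9)"
    and "a2 = - 3 * k * (k + 2) * (2 * k + 1)^2 * int n
                - (28 * k^4 + 72 * k^3 + 60 * k^2 + 20 * k + 9)"
    and "a3 = - 3 * k * (k + 2) * (3 * k^2 + 6 * k + 1) * int n
                - (9 * k^4 + 36 * k^3 + 46 * k^2 + 20 * k + 9)"
    and "b1 = - 6 * k * (k + 2) * (k - 1) * int n - (20 * k^3 + 20 * k^2 - 16 * k - 6)"
    and "b2 = 6 * k * (k + 2) * (2 * k + 1) * int n + (28 * k^3 + 64 * k^2 + 46 * k + 6)"
    and "b3 = 6 * k * (k + 2) * int n + (14 * k^2 + 22 * k + 6)"
    and "c1 = k^2 + 2 * k + 9"
  shows "real_of_int (\<Sum>i=0..n. int i * (pell_tribonacci k i)^2) =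
      real_of_int (a1 * (pell_tribonacci k (n + 3))^2 + a2 * (pell_tribonacci k (n + 2))^2
                   + a3 * (pell_tribonacci k (n + 1))^2)
        / real_of_int (9 * k^2 * (k + 2)^2)
    + real_of_int (b1 * pell_tribonacci k (n + 1) * pell_tribonacci k (n + 2)
                   + b2 * pell_tribonacci k (n + 2) * pell_tribonacci k (n + 3)
                   + b3 * pell_tribonacci k (n + 1) * pell_tribonacci k (n + 3) + c1)
        / real_of_int (9 * k^2 * (k + 2)^2)"
proof -
  have quotient: "real_of_int S = real_of_int A / real_of_int D + real_of_int B / real_of_int D"
    if "D \<noteq> 0" "D * S = A + B" for A B D S
    using that by (simp add: add_divide_distrib[symmetric] eq_divide_eq mult.commute
        flip: of_int_add of_int_mult)
  show ?thesis
  proof (rule quotient)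
    \<comment> \<open>\<open>k \<ge> 1\<close> excludes the roots 0 and -2 of the
      denominator.\<close>
    show "9 * k^2 * (k + 2)^2 \<noteq> 0"
      using \<open>k \<ge> 1\<close> by simp
  \<comment> \<open>The two numerators add up to the right side of the lemma, up to the order of
    summands and factors.\<close>
  qed (unfold assms(2-) pell_tribonacci_weighted_square_sum, simp only: ac_simps)
qed

end
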